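(* There are infinitely many rational Diophantine sextuples such that the denominators of all the elements (written in lowest terms) of the sextuple are perfect squares.
   Context: A rational Diophantine $m$-tuple is a set of $m$ nonzero rational numbers $\{a_1,\ldots,a_m\}$ such that $a_ia_j+1$ is the square of a rational number for all $1\le i<j\le m$. A rational Diophantine sextuple is a rational Diophantine $6$-tuple. *)

theory Defs
  imports Complex_Main "HOL-Computational_Algebra.Nth_Powers"
begin

definition rational_diophantine_tuple :: "nat \<Rightarrow> rat set \<Rightarrow> bool" where
  "rational_diophantine_tuple m S \<longleftrightarrow>
     finite S \<and> card S = m \<and> 0 \<notin> S \<and>
     (\<forall>a\<in>S. \<forall>b\<in>S. a \<noteq> b \<longrightarrow> is_square (a * b + 1))"

abbreviation rational_diophantine_sextuple :: "rat set \<Rightarrow> bool" where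
  "rational_diophantine_sextuple \<equiv> rational_diophantine_tuple 6"

(* quotient_of returns the coprime numerator and denominator, with denominator > 0 *)
definition denominator :: "rat \<Rightarrow> int" where
  "denominator q = snd (quotient_of q)"

end

theory Submission
  imports Defs
begin

text \<open>
  Let \<open>a b + 1 = r\<^sup>2\<close> and \<open>c d + 1 = w\<^sup>2\<close> with \<open>1 / r + 1 / w = 1\<close>, and let \<open>e, f\<close> be the two numbers
  extending a Diophantine quadruple \<open>a, b, c, d\<close> to a regular quintuple. Then
  \<open>e f + 1 = ((a + b - c - d) / (a b c d - 1))\<^sup>2\<close>, so that \<open>a, b, c, d, e, f\<close> is a Diophantine sextuple
  as soon as it is nondegenerate. Taking \<open>r = (2 - X\<^sup>2) / 2\<close>, \<open>a c = - (24 / 25)\<^sup>2\<close> and \<open>a d = X\<^sup>2 - 1\<close> leaves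
  a single condition, that \<open>X\<close> lies on the genus one quartic \<open>V\<^sup>2 = 625 (X\<^sup>2 - 2)\<^sup>2 - 49 X\<^sup>2\<close>.
  All denominators are squares if \<open>X\<close> is a 3-adic unit with even denominator: for \<open>a, b, c, d\<close> by
  inspection, and for \<open>e, f\<close> because \<open>a x + 1\<close> being a square forces every prime of odd
  multiplicity in the denominator of \<open>x\<close> to divide the numerator of \<open>a\<close>. Such \<open>X\<close> are the translates
  of \<open>X = 25 / 16\<close> by points that are 2-adically and 3-adically close to the origin; doubling these
  points brings them strictly closer 2-adically, which gives infinitely many.
\<close>

subsection \<open>Square denominators\<close>

lemma rat_square_of_int:
  fixes r :: rat
  assumes "r ^ 2 = of_int k"
  obtains m where "r = of_int m"
proof -
  obtain p q where pq: "quotient_of r = (p, q)" by force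
  have r: "r = of_int p / of_int q" and "q > 0" and cop: "coprime p q"
    using pq quotient_of_div quotient_of_denom_pos quotient_of_coprime by blast+
  have "of_int (p ^ 2) = (of_int (k * q ^ 2) :: rat)"
    using assms \<open>q > 0\<close> by (simp add: r power_divide divide_simps)
  then have "p ^ 2 = k * q ^ 2" by (simp only: of_int_eq_iff)
  then have "q dvd p ^ 2" by (simp add: power2_eq_square)
  moreover have "coprime (p ^ 2) q" using cop by simp
  ultimately have "is_unit q" using coprime_common_divisor dvd_refl by blast
  with \<open>q > 0\<close> have "q = 1" by simp
  with r that show ?thesis by simp
qed

lemma denominator_quotient:
  assumes "coprime p q" "q > 0"
  shows "denominator (of_int p / of_int q) = q"
  using assms by (simp add: denominator_def flip: Fract_of_int_quotient)
    (simp add: quotient_of_Fract normalize_def)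

text \<open>The reduced denominator of \<open>s / n\<close> divides \<open>n\<close>, so it is
  coprime to \<open>M\<close> and its square is the reduced denominator of the product.\<close>

lemma is_square_denominator_int_mult_square:
  assumes "coprime M n" "n \<noteq> 0"
  shows "is_square (denominator (of_int M * (of_int s / of_int n) ^ 2))"
proof -
  obtain u v where uv: "quotient_of (of_int s / of_int n) = (u, v)" by force
  have eq: "of_int s / of_int n = (of_int u / of_int v :: rat)" and "v > 0" and cop: "coprime u v"
    using uv quotient_of_div quotient_of_denom_pos quotient_of_coprime by blast+
  have "of_int (s * v) = (of_int (u * n) :: rat)"
    using eq \<open>v > 0\<close> \<open>n \<noteq> 0\<close> by (simp add: divide_simps split: if_splits)
  then have "s * v = u * n" by (simp only: of_int_eq_iff)
  then have "v dvd n" using cop by (metis coprime_commute coprime_dvd_mult_right_iff dvd_triv_right)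
  then have "coprime M v" using assms(1) by (meson coprime_divisors dvd_refl)
  then have "coprime (M * u ^ 2) (v ^ 2)" using cop by simp
  then have "denominator (of_int (M * u ^ 2) / of_int (v ^ 2)) = v ^ 2"
    using \<open>v > 0\<close> by (intro denominator_quotient) auto
  moreover have "of_int M * (of_int s / of_int n) ^ 2 = (of_int (M * u ^ 2) / of_int (v ^ 2) :: rat)"
    by (simp add: eq power_divide)
  ultimately show ?thesis by simp
qed

text \<open>With \<open>a = A / b0^2\<close> and \<open>x = N / D\<close> in lowest terms,
  \<open>(A N + b0^2 D) D\<close> is a perfect square. Odd multiplicity of \<open>p\<close> in
  \<open>D\<close> forces \<open>p\<close> into the other factor, hence into \<open>A N\<close>,
  hence into \<open>A\<close>.\<close>

lemma prime_dvd_if_odd_multiplicity_denominator: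
  fixes a x :: rat
  assumes "is_square (denominator a)" "is_square (a * x + 1)"
    and p: "prime p" "odd (multiplicity p (denominator x))"
    and a: "a = of_int n / of_int k" "k \<noteq> 0"
  shows "p dvd n"
proof -
  obtain b0 where b0: "denominator a = b0 ^ 2" using assms(1) by (elim is_nth_powerE)
  obtain r where r: "a * x + 1 = r ^ 2" using assms(2) by (elim is_nth_powerE)
  obtain A where A: "quotient_of a = (A, b0 ^ 2)"
    using b0 unfolding denominator_def by (metis prod.collapse)
  obtain N D where ND: "quotient_of x = (N, D)" by force
  have a': "a = of_int A / of_int (b0 ^ 2)" and copA: "coprime A (b0 ^ 2)" and "b0 ^ 2 > 0"
    using A quotient_of_div quotient_of_denom_pos quotient_of_coprime by blast+
  have x': "x = of_int N / of_int D" and copN: "coprime N D" and "D > 0"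
    using ND quotient_of_div quotient_of_denom_pos quotient_of_coprime by blast+
  have "b0 \<noteq> 0" using \<open>b0 ^ 2 > 0\<close> by auto
  have "(r * of_int b0 * of_int D) ^ 2 = of_int ((A * N + b0 ^ 2 * D) * D)"
    using \<open>b0 \<noteq> 0\<close> \<open>D > 0\<close>
    by (simp add: power_mult_distrib flip: r) (simp add: a' x' field_simps power2_eq_square)
  then obtain m where m: "r * of_int b0 * of_int D = of_int m"
    by (elim rat_square_of_int)
  with \<open>(r * of_int b0 * of_int D) ^ 2 = _\<close> have "of_int (m ^ 2) = (of_int ((A * N + b0 ^ 2 * D) * D) :: rat)"
    by simp
  then have m2: "m ^ 2 = (A * N + b0 ^ 2 * D) * D" by (simp only: of_int_eq_iff)
  have odd: "odd (multiplicity p D)" using p(2) ND by (simp add: denominator_def)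
  then have "p dvd D" using not_dvd_imp_multiplicity_0 by fastforce
  have "p dvd A * N + b0 ^ 2 * D"
  proof (rule ccontr)
    assume *: "\<not> p dvd A * N + b0 ^ 2 * D"
    then have "A * N + b0 ^ 2 * D \<noteq> 0" by auto
    with * p(1) \<open>D > 0\<close> have "multiplicity p (m ^ 2) = multiplicity p D"
      unfolding m2 by (subst prime_elem_multiplicity_mult_distrib) (auto simp: not_dvd_imp_multiplicity_0)
    moreover have "m \<noteq> 0" using m2 \<open>D > 0\<close> \<open>A * N + b0 ^ 2 * D \<noteq> 0\<close> by auto
    ultimately show False
      using odd prime_elem_multiplicity_power_distrib[OF prime_imp_prime_elem[OF p(1)], of m 2]
      by (metis dvd_triv_left)
  qed
  with \<open>p dvd D\<close> have "p dvd A * N" by (simp add: dvd_add_left_iff)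
  with p(1) copN \<open>p dvd D\<close> have "p dvd A"
    by (meson coprime_common_divisor not_prime_unit prime_dvd_mult_iff)
  have "of_int (A * k) = (of_int (n * b0 ^ 2) :: rat)"
    using a' a \<open>b0 \<noteq> 0\<close> by (simp add: divide_simps)
  then have "A * k = n * b0 ^ 2" by (simp only: of_int_eq_iff)
  with \<open>p dvd A\<close> have "p dvd n * b0 ^ 2" by (metis dvd_mult2)
  moreover have "\<not> p dvd b0 ^ 2"
    using \<open>p dvd A\<close> copA p(1) by (meson coprime_common_divisor not_prime_unit)
  ultimately show ?thesis using p(1) by (simp add: prime_dvd_mult_iff)
qed

lemma is_square_denominatorI:
  assumes "\<And>p. prime p \<Longrightarrow> even (multiplicity p (denominator x))"
  shows "is_square (denominator x)"
proof -
  have "is_square (normalize (denominator x))"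
    using assms by (subst is_nth_power_conv_multiplicity) auto
  moreover have "denominator x > 0" by (simp add: denominator_def quotient_of_denom_pos')
  ultimately show ?thesis by simp
qed

subsection \<open>The family of sextuples\<close>

text \<open>On the quartic \<open>V\<^sup>2 = 625 (X\<^sup>2 - 2)\<^sup>2 - 49 X\<^sup>2\<close>, the elements \<open>fam_e X V\<close> and
  \<open>fam_e X (- V)\<close> are the two extensions of the quadruple \<open>a, b, c, d\<close> to a regular quintuple.\<close>

definition fam_a :: "rat \<Rightarrow> rat" where "fam_a X = 12 * X ^ 2 / 25"
definition fam_b :: "rat \<Rightarrow> rat" where "fam_b X = 25 * (X ^ 2 - 4) / 48"
definition fam_c :: "rat \<Rightarrow> rat" where "fam_c X = - 48 / (25 * X ^ 2)"
definition fam_d :: "rat \<Rightarrow> rat" where "fam_d X = 25 * (X ^ 2 - 1) / (12 * X ^ 2)"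
definition fam_e :: "rat \<Rightarrow> rat \<Rightarrow> rat" where
  "fam_e X V = 7 * (7 * (X ^ 4 - 4) + 4 * V * X) / (1200 * (X ^ 2 - 2) ^ 2)"

lemmas fam_defs = fam_a_def fam_b_def fam_c_def fam_d_def fam_e_def

definition fam_set :: "rat \<Rightarrow> rat \<Rightarrow> rat set" where
  "fam_set X V = {fam_a X, fam_b X, fam_c X, fam_d X, fam_e X V, fam_e X (- V)}"

text \<open>Five of these are identities in \<open>X\<close>; only \<open>b d + 1\<close> uses the
  quartic.\<close>

lemma fam_squares_base:
  assumes V: "V ^ 2 = 625 * (X ^ 2 - 2) ^ 2 - 49 * X ^ 2" and "X \<noteq> 0"
  shows "fam_a X * fam_b X + 1 = ((X ^ 2 - 2) / 2) ^ 2"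
    and "fam_a X * fam_c X + 1 = (7 / 25) ^ 2"
    and "fam_a X * fam_d X + 1 = X ^ 2"
    and "fam_b X * fam_c X + 1 = (2 / X) ^ 2"
    and "fam_b X * fam_d X + 1 = (V / (24 * X)) ^ 2"
    and "fam_c X * fam_d X + 1 = ((X ^ 2 - 2) / X ^ 2) ^ 2"
proof -
  note [simp] = fam_defs power_divide divide_simps
  show "fam_a X * fam_b X + 1 = ((X ^ 2 - 2) / 2) ^ 2" by (simp, algebra)
  show "fam_a X * fam_c X + 1 = (7 / 25) ^ 2" using \<open>X \<noteq> 0\<close> by simp
  show "fam_a X * fam_d X + 1 = X ^ 2" using \<open>X \<noteq> 0\<close> by simp
  show "fam_b X * fam_c X + 1 = (2 / X) ^ 2" using \<open>X \<noteq> 0\<close> by simp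
  show "fam_b X * fam_d X + 1 = (V / (24 * X)) ^ 2"
    using \<open>X \<noteq> 0\<close> by (simp, use V in algebra)
  show "fam_c X * fam_d X + 1 = ((X ^ 2 - 2) / X ^ 2) ^ 2"
    using \<open>X \<noteq> 0\<close> by (simp, algebra)
qed

lemma fam_squares_e:
  assumes V: "V ^ 2 = 625 * (X ^ 2 - 2) ^ 2 - 49 * X ^ 2" and nz: "X \<noteq> 0" "X ^ 2 \<noteq> 2"
  shows "fam_a X * fam_e X V + 1 = ((2 * V + 7 * X ^ 3) / (50 * (X ^ 2 - 2))) ^ 2"
    and "fam_b X * fam_e X V + 1 = ((2 * V + 7 * X * (X ^ 2 - 4)) / (48 * (X ^ 2 - 2))) ^ 2"
    and "fam_c X * fam_e X V + 1 = ((14 - V * X) / (25 * X * (X ^ 2 - 2))) ^ 2"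
    and "fam_d X * fam_e X V + 1 = ((14 * (X ^ 2 - 1) + V * X) / (24 * X * (X ^ 2 - 2))) ^ 2"
proof -
  have nz': "X ^ 2 - 2 \<noteq> 0" using nz by simp
  note [simp] = fam_defs power_divide divide_simps
  show "fam_a X * fam_e X V + 1 = ((2 * V + 7 * X ^ 3) / (50 * (X ^ 2 - 2))) ^ 2"
    using nz nz' by (simp, use V in algebra)
  show "fam_b X * fam_e X V + 1 = ((2 * V + 7 * X * (X ^ 2 - 4)) / (48 * (X ^ 2 - 2))) ^ 2"
    using nz nz' by (simp, use V in algebra)
  show "fam_c X * fam_e X V + 1 = ((14 - V * X) / (25 * X * (X ^ 2 - 2))) ^ 2"
    using nz nz' by (simp, use V in algebra)
  show "fam_d X * fam_e X V + 1 = ((14 * (X ^ 2 - 1) + V * X) / (24 * X * (X ^ 2 - 2))) ^ 2"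
    using nz nz' by (simp, use V in algebra)
qed

text \<open>Up to sign the root is \<open>(a + b - c - d) / (a b c d - 1)\<close>, where
  \<open>a b c d - 1 = - (X^2 - 2)^2 / X^2\<close>.\<close>

lemma fam_squares_ef:
  assumes V: "V ^ 2 = 625 * (X ^ 2 - 2) ^ 2 - 49 * X ^ 2" and nz: "X \<noteq> 0" "X ^ 2 \<noteq> 2"
  shows "fam_e X V * fam_e X (- V) + 1
    = ((1201 * (X ^ 4 + 4) - 5000 * X ^ 2) / (1200 * (X ^ 2 - 2) ^ 2)) ^ 2"
proof -
  have "X ^ 2 - 2 \<noteq> 0" using nz by simp
  with nz show ?thesis
    by (simp add: fam_e_def power_divide divide_simps, use V in algebra)
qed

text \<open>\<open>dyadic k q\<close> says that \<open>q\<close> has 2-adic valuation \<open>k - 12\<close>; the shift keeps the exponent natural.\<close>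

definition dyadic :: "nat \<Rightarrow> rat \<Rightarrow> bool" where
  "dyadic k q \<longleftrightarrow> (\<exists>p r :: int. odd p \<and> odd r \<and> 2 ^ 12 * q = 2 ^ k * of_int p / of_int r)"

lemma dyadicI:
  "odd p \<Longrightarrow> odd r \<Longrightarrow> 2 ^ 12 * q = 2 ^ k * of_int p / of_int r \<Longrightarrow> dyadic k q"
  unfolding dyadic_def by blast

lemma dyadic_nonzero: "dyadic k q \<Longrightarrow> q \<noteq> 0"
  unfolding dyadic_def by force

lemma odd_power2_mult_eq_imp_le:
  fixes p q :: int
  assumes "odd q" "2 ^ k * p = 2 ^ l * q"
  shows "k \<le> l"
proof -
  have "(2 :: int) ^ k dvd 2 ^ l * q" using assms(2) by (metis dvd_triv_left)
  then have "(2 :: int) ^ k dvd 2 ^ l" using assms(1) by (simp add: coprime_dvd_mult_left_iff)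
  then show ?thesis by (simp add: dvd_power_iff)
qed

lemma odd_power2_mult_eq:
  fixes p q :: int
  assumes "odd p" "odd q" "2 ^ k * p = 2 ^ l * q"
  shows "k = l"
  using odd_power2_mult_eq_imp_le[of q k p l] odd_power2_mult_eq_imp_le[of p l q k] assms by simp

lemma dyadic_unique:
  assumes "dyadic k q" "dyadic l q"
  shows "k = l"
proof -
  obtain p r where 1: "odd p" "odd r" "2 ^ 12 * q = 2 ^ k * of_int p / of_int r"
    using assms(1) unfolding dyadic_def by blast
  obtain p' r' where 2: "odd p'" "odd r'" "2 ^ 12 * q = 2 ^ l * of_int p' / of_int r'"
    using assms(2) unfolding dyadic_def by blast
  have nz: "r \<noteq> 0" "r' \<noteq> 0" using 1 2 by auto
  have "2 ^ k * of_int p / of_int r = (2 ^ l * of_int p' / of_int r' :: rat)" using 1(3) 2(3) by argo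
  with nz have "of_int (2 ^ k * (p * r')) = (of_int (2 ^ l * (p' * r)) :: rat)"
    by (simp add: divide_simps mult_ac)
  then have "2 ^ k * (p * r') = 2 ^ l * (p' * r)" by (simp only: of_int_eq_iff)
  then show ?thesis using 1 2 by (intro odd_power2_mult_eq[of "p * r'" "p' * r"]) auto
qed

lemma fam_e_quotient:
  assumes "M \<noteq> 0" "Y ^ 2 \<noteq> 512 * M ^ 2"
  shows "2 ^ 12 * fam_e (Y / (16 * M)) (Z / (16 * M) ^ 2)
    = 2 ^ 8 * (7 * (7 * (Y ^ 4 - 4 * (16 * M) ^ 4) + 64 * Z * M * Y)) / (75 * (Y ^ 2 - 512 * M ^ 2) ^ 2)"
proof -
  have nz: "Y ^ 2 - 512 * M ^ 2 \<noteq> 0" using assms by simp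
  have "(Y / (16 * M)) ^ 2 - 2 = (Y ^ 2 - 512 * M ^ 2) / (16 * M) ^ 2"
    using assms by (simp add: field_simps)
  with assms nz show ?thesis
    unfolding fam_e_def by (simp add: power_divide divide_simps) algebra
qed

text \<open>\<open>X\<close> has 2-adic valuation -4, and in the numerator of \<open>e\<close> the
  term \<open>X^4\<close> dominates whatever \<open>W\<close> is. The five valuations differ, so
  only \<open>e = f\<close> remains to be excluded; the least one, -12 for \<open>b\<close>,
  explains the shift in \<open>dyadic\<close>.\<close>

lemma fam_dyadic:
  fixes m y W :: int
  assumes odd: "odd m" "odd y"
  defines "X \<equiv> of_int y / of_int (16 * m)" and "V \<equiv> of_int W / of_int ((16 * m) ^ 2)"
  shows "dyadic 6 (fam_a X)" "dyadic 0 (fam_b X)" "dyadic 24 (fam_c X)" "dyadic 10 (fam_d X)"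
    "dyadic 8 (fam_e X V)"
proof -
  have nz: "m \<noteq> 0" "y \<noteq> 0" using odd by auto
  have "y ^ 2 \<noteq> 512 * m ^ 2" using odd by (metis even_mult_iff even_numeral even_power)
  then have "of_int (y ^ 2) \<noteq> (of_int (512 * m ^ 2) :: rat)" by (metis of_int_eq_iff)
  then have nz2: "(of_int y :: rat) ^ 2 \<noteq> 512 * of_int m ^ 2" by simp
  note s = fam_defs X_def V_def power_mult_distrib power_divide divide_simps nz nz2
  show "dyadic 6 (fam_a X)"
    by (rule dyadicI[of "3 * y ^ 2" "25 * m ^ 2"]) (use odd in \<open>simp_all add: s\<close>)
  show "dyadic 0 (fam_b X)"
    by (rule dyadicI[of "25 * (y ^ 2 - 1024 * m ^ 2)" "3 * m ^ 2"]) (use odd in \<open>simp_all add: s\<close>)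
  show "dyadic 24 (fam_c X)"
    by (rule dyadicI[of "- 3 * m ^ 2" "25 * y ^ 2"]) (use odd in \<open>simp_all add: s\<close>)
  show "dyadic 10 (fam_d X)"
    by (rule dyadicI[of "25 * (y ^ 2 - 256 * m ^ 2)" "3 * y ^ 2"]) (use odd in \<open>simp_all add: s\<close>)
  show "dyadic 8 (fam_e X V)"
    using fam_e_quotient[of "of_int m" "of_int y" "of_int W"] nz nz2 odd
    by (intro dyadicI[of "7 * (7 * (y ^ 4 - 4 * (16 * m) ^ 4) + 64 * W * m * y)"
          "75 * (y ^ 2 - 512 * m ^ 2) ^ 2"]) (simp_all add: X_def V_def)
qed

section \<open>Denominators of the family\<close>

lemma coprime_diff_mult_self:
  fixes a k n :: int
  assumes "coprime a n"
  shows "coprime (a - k * n) n"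
  using assms gcd_add_mult[of n "- k" a] by (simp add: coprime_iff_gcd_eq_1 gcd.commute)

lemma fam_denominators:
  fixes x y :: int
  assumes V: "V ^ 2 = 625 * (X ^ 2 - 2) ^ 2 - 49 * X ^ 2"
    and X: "X = of_int y / of_int x"
    and xy: "coprime x y" "even x" "odd y" "\<not> 3 dvd x" "\<not> 3 dvd y" "x \<noteq> 0" "X ^ 2 \<noteq> 2"
  shows "is_square (denominator (fam_a X))" "is_square (denominator (fam_b X))"
    "is_square (denominator (fam_c X))" "is_square (denominator (fam_d X))"
    "is_square (denominator (fam_e X V))"
proof -
  have "y \<noteq> 0" using xy by auto
  then have "X \<noteq> 0" using X xy by simp
  have sq1: "n mod 3 = 1 \<or> n mod 3 = 2 \<Longrightarrow> n ^ 2 mod 3 = 1" for n :: int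
    by (subst power_mod[symmetric]) auto
  \<comment> \<open>This cancels the 3 in the constants 48 of \<open>b\<close> and 12 of
    \<open>d\<close>, leaving \<open>b = M (5 / (4 x))^2\<close> and
    \<open>d = N (5 / (2 y))^2\<close>.\<close>
  have m3: "x ^ 2 mod 3 = 1" "y ^ 2 mod 3 = 1" using xy by (intro sq1; presburger)+
  then have "3 dvd y ^ 2 - 4 * x ^ 2" "3 dvd y ^ 2 - x ^ 2" by presburger+
  then obtain M N where M: "y ^ 2 - 4 * x ^ 2 = 3 * M" and N: "y ^ 2 - x ^ 2 = 3 * N" by (elim dvdE)
  have cop3: "coprime 3 x" "coprime 3 y"
    using xy prime_imp_coprime_int[of 3] by auto
  have cop35: "coprime (3 :: int) 5" using prime_imp_coprime_int[of 3 5] by simp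
  have rM: "of_int M = ((of_int y) ^ 2 - 4 * (of_int x) ^ 2 :: rat) / 3"
    using arg_cong[OF M, of "of_int :: int \<Rightarrow> rat"] by simp
  have rN: "of_int N = ((of_int y) ^ 2 - (of_int x) ^ 2 :: rat) / 3"
    using arg_cong[OF N, of "of_int :: int \<Rightarrow> rat"] by simp
  note s = fam_defs X power_mult_distrib power_divide divide_simps
  have "coprime (3 * M) (4 * x)"
  proof -
    have "coprime y (2 ^ 2 * x)"
      using xy by (simp only: coprime_mult_right_iff coprime_power_right_iff coprime_commute[of y x]
          coprime_right_2_iff_odd) simp
    then have "coprime y (4 * x)" by simp
    then have "coprime (y ^ 2) (4 * x)" by simp
    moreover have "y ^ 2 - x * (4 * x) = 3 * M" using M by (simp add: power2_eq_square)
    ultimately show ?thesis using coprime_diff_mult_self by metis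
  qed
  then have cM: "coprime M (4 * x)" by simp
  have "coprime (3 * N) (2 * y)"
  proof -
    have "odd (y ^ 2 - x ^ 2)" using xy by simp
    moreover have "coprime (y ^ 2 - x ^ 2) y"
      using coprime_diff_mult_self[of "- (x ^ 2)" y "- y"] xy by (simp add: power2_eq_square)
    ultimately have "coprime (y ^ 2 - x ^ 2) (2 * y)" by simp
    then show ?thesis unfolding N .
  qed
  then have cN: "coprime N (2 * y)" by simp
  have "fam_a X = of_int 3 * (of_int (2 * y) / of_int (5 * x)) ^ 2"
    using xy by (simp add: s)
  moreover have "coprime 3 (5 * x)" using cop3 cop35 by simp
  ultimately show a: "is_square (denominator (fam_a X))"
    using is_square_denominator_int_mult_square[of "3" "5 * x" "2 * y"] xy by simp
  have "fam_c X = of_int (- 3) * (of_int (4 * x) / of_int (5 * y)) ^ 2"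
    using xy \<open>y \<noteq> 0\<close> by (simp add: s)
  moreover have "coprime (- 3) (5 * y)" using cop3 cop35 by simp
  ultimately show c: "is_square (denominator (fam_c X))"
    using is_square_denominator_int_mult_square[of "- 3" "5 * y" "4 * x"] \<open>y \<noteq> 0\<close> by simp
  have "fam_b X = of_int M * (of_int 5 / of_int (4 * x)) ^ 2"
    using xy by (simp add: s rM)
  then show b: "is_square (denominator (fam_b X))"
    using is_square_denominator_int_mult_square[of "M" "4 * x" "5"] cM xy by simp
  have "fam_d X = of_int N * (of_int 5 / of_int (2 * y)) ^ 2"
    using xy \<open>y \<noteq> 0\<close> by (simp add: s rN)
  then show d: "is_square (denominator (fam_d X))"
    using is_square_denominator_int_mult_square[of "N" "2 * y" "5"] cN \<open>y \<noteq> 0\<close> by simp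
  \<comment> \<open>A prime of odd multiplicity in the denominator would divide the numerators of
    \<open>a, b, c, d\<close>, which are coprime.\<close>
  show "is_square (denominator (fam_e X V))"
  proof (rule is_square_denominatorI, rule ccontr)
    fix p :: int
    assume p: "prime p" "odd (multiplicity p (denominator (fam_e X V)))"
    note sq = fam_squares_e[OF V \<open>X \<noteq> 0\<close> \<open>X ^ 2 \<noteq> 2\<close>, THEN is_nth_powerI]
    have "p dvd 12 * y ^ 2"
      using xy by (intro prime_dvd_if_odd_multiplicity_denominator[OF a sq(1) p, of _ "25 * x ^ 2"])
        (simp_all add: s)
    moreover have "p dvd 48 * x ^ 2"
      using \<open>y \<noteq> 0\<close> xy prime_dvd_if_odd_multiplicity_denominator[OF c sq(3) p, of "- (48 * x ^ 2)" "25 * y ^ 2"]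
      by (simp add: s)
    ultimately have "p dvd 12 \<or> p dvd y" "p dvd 48 \<or> p dvd x"
      using p(1) by (auto simp: prime_dvd_mult_iff prime_dvd_power_iff)
    moreover have "\<not> (p dvd x \<and> p dvd y)"
      using xy p(1) by (meson coprime_common_divisor not_prime_unit)
    ultimately have "p dvd 12 \<or> p dvd 48" by blast
    then have "p dvd 2 ^ 4 * 3" by (auto intro: dvd_trans[of _ 12 48])
    then have "p dvd 2 \<or> p dvd 3"
      using p(1) prime_dvd_multD[of p "2 ^ 4" 3] prime_dvd_power[of p 2 4] by blast
    then have p23: "p = 2 \<or> p = 3"
      using primes_dvd_imp_eq[OF p(1), of 2] primes_dvd_imp_eq[OF p(1), of 3] by auto
    have "p dvd M * 25"
      using xy by (intro prime_dvd_if_odd_multiplicity_denominator[OF b sq(2) p, of _ "16 * x ^ 2"])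
        (simp_all add: s rM)
    moreover have "p dvd N * 25"
      using xy \<open>y \<noteq> 0\<close> by (intro prime_dvd_if_odd_multiplicity_denominator[OF d sq(4) p, of _ "4 * y ^ 2"])
        (simp_all add: s rN)
    ultimately have "p dvd M" "p dvd N"
      using p23 by (elim disjE; simp; presburger)+
    moreover have "x ^ 2 = N - M" using M N by simp
    ultimately have "p dvd x ^ 2" by simp
    then have "p dvd x" by (rule prime_dvd_power[OF p(1)])
    with p23 xy have "p = 2" by auto
    with \<open>p dvd M\<close> have "even (3 * M)" by simp
    then show False using xy M[symmetric] by simp
  qed
qed

subsection \<open>Points on the quartic\<close>

text \<open>With \<open>u = 96 A / B\<close> and \<open>v = C / (25 B\<^sup>2)\<close> this is the Jacobi quartic
  \<open>v\<^sup>2 = u\<^sup>4 / 4 - 2549 u\<^sup>2 / 2500 + 1\<close>, which is the quartic above for \<open>X = u\<close>, \<open>V = 50 v\<close>.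
  The next two lemmas are doubling and translation by \<open>(25 / 16, 15 / 512)\<close>
  for the group law with neutral element \<open>(u, v) = (0, 1)\<close>.\<close>

definition curve_pt :: "int \<Rightarrow> int \<Rightarrow> int \<Rightarrow> bool" where
  "curve_pt A B C \<longleftrightarrow> C ^ 2 = 625 * B ^ 4 - 5872896 * A ^ 2 * B ^ 2 + 625 * 21233664 * A ^ 4"

lemma curve_pt_double:
  assumes "curve_pt A B C"
  shows "curve_pt (2 * A * B * C) (25 * (B ^ 4 - 21233664 * A ^ 4))
    (25 * ((B ^ 4 + 21233664 * A ^ 4) * (C ^ 2 - 5872896 * A ^ 2 * B ^ 2)
       + 2500 * 21233664 * A ^ 4 * B ^ 4))"
  using assms unfolding curve_pt_def by algebra

lemma curve_pt_translate:
  assumes "curve_pt A B C"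
  defines "x \<equiv> 16 * (B ^ 2 - 5625 * A ^ 2)" and "y \<equiv> C + 45 * A * B"
    and "W \<equiv> (B ^ 2 + 5625 * A ^ 2) * (15 * C - 1957632 * A * B)
      + 2343750 * A * B ^ 3 + 8847360000 * A ^ 3 * B"
  shows "W ^ 2 = 625 * (y ^ 2 - 2 * x ^ 2) ^ 2 - 49 * x ^ 2 * y ^ 2"
  using assms(1) unfolding curve_pt_def x_def y_def W_def by algebra

text \<open>The point \<open>(u, v)\<close> is close to the neutral element 2-adically and 3-adically, and \<open>k\<close>
  measures the 2-adic distance exactly.\<close>

definition good_pt :: "nat \<Rightarrow> int \<Rightarrow> int \<Rightarrow> int \<Rightarrow> bool" where
  "good_pt k A B C \<longleftrightarrow> curve_pt A B C \<and> (\<exists>s. odd s \<and> A = 2 ^ k * s) \<and>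
     2 ^ Suc k dvd C - 25 * B ^ 2 \<and> coprime B 6 \<and> coprime C 6"

lemma coprime_6_iff: "coprime n 6 \<longleftrightarrow> odd n \<and> \<not> 3 dvd (n :: int)"
proof -
  have "coprime n (2 * 3) \<longleftrightarrow> coprime n 2 \<and> coprime n 3" by (rule coprime_mult_right_iff)
  moreover have "coprime n 3 \<longleftrightarrow> \<not> 3 dvd n"
    using prime_imp_coprime_int[of 3 n] by (auto simp: coprime_commute coprime_absorb_left)
  ultimately show ?thesis by simp
qed

text \<open>This is, up to the sign of \<open>v\<close>, six times the point \<open>(u, v) = (1, 12 / 25)\<close>.\<close>

lemma good_pt_base: "good_pt 0 (- 199454381) 15066146075 415482839329546792625"
  unfolding good_pt_def curve_pt_def coprime_6_iff by simp

text \<open>As \<open>B\<close> and \<open>C\<close> are odd, \<open>2 A B C\<close> gains exactly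
  one factor 2. On the curve, \<open>C' - 25 B'^2\<close> is a multiple of \<open>4 A^2\<close>.
  Modulo 6, \<open>B'\<close> is \<open>25 B^4\<close> and \<open>C'\<close> is
  \<open>25 B^4 C^2\<close>.\<close>

lemma good_pt_double:
  assumes "good_pt k A B C"
  shows "\<exists>A B C. good_pt (Suc k) A B C"
proof -
  \<comment> \<open>This is \<open>96^4 / 4\<close>, from substituting \<open>u = 96 A / B\<close>
    in \<open>u^4 / 4\<close>.\<close>
  define E where "E = (21233664 :: int)"
  define A' B' C' where A': "A' = 2 * A * B * C" and B': "B' = 25 * (B ^ 4 - E * A ^ 4)"
    and C': "C' = 25 * ((B ^ 4 + E * A ^ 4) * (C ^ 2 - 5872896 * A ^ 2 * B ^ 2) + 2500 * E * A ^ 4 * B ^ 4)"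
  have pt: "curve_pt A B C" and k: "2 ^ Suc k dvd C - 25 * B ^ 2" and BC: "coprime B 6" "coprime C 6"
    using assms unfolding good_pt_def by auto
  obtain s where s: "odd s" "A = 2 ^ k * s" using assms unfolding good_pt_def by blast
  have "curve_pt A' B' C'" using curve_pt_double[OF pt] unfolding A' B' C' E_def by simp
  moreover have "A' = 2 ^ Suc k * (s * B * C)" by (simp add: A' s)
  moreover have "odd (s * B * C)" using s BC by (simp add: coprime_6_iff)
  moreover have "2 ^ Suc (Suc k) dvd C' - 25 * B' ^ 2"
  proof -
    have "C' - 25 * B' ^ 2 = (4 * A ^ 2) * (25 * (- 2936448 * B ^ 2 * (B ^ 4 + E * A ^ 4)
        + 1250 * E * A ^ 2 * B ^ 4))"
      using pt unfolding curve_pt_def C' B' E_def by algebra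
    moreover have "(2 :: int) ^ Suc (Suc k) dvd 4 * A ^ 2" by (simp add: s power2_eq_square)
    ultimately show ?thesis by (metis dvd_mult2)
  qed
  moreover have "coprime B' 6" "coprime C' 6"
  proof -
    have *: "coprime n 6 \<Longrightarrow> coprime (n + 6 * j) 6" for n j :: int
      unfolding coprime_6_iff by presburger
    have "B' = 25 * B ^ 4 + 6 * (- 25 * 3538944 * A ^ 4)" by (simp add: B' E_def)
    moreover have "coprime (25 * B ^ 4) 6" using BC by (simp add: coprime_6_iff prime_dvd_power_iff prime_dvd_mult_iff)
    ultimately show "coprime B' 6" using * by metis
    have "C' = 25 * (B ^ 4 * C ^ 2) + 6 * (25 * (- 978816 * A ^ 2 * B ^ 6 + 3538944 * A ^ 4 * (C ^ 2 - 5872896 * A ^ 2 * B ^ 2)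
       + 2500 * 3538944 * A ^ 4 * B ^ 4))"
      unfolding C' E_def by algebra
    moreover have "coprime (25 * (B ^ 4 * C ^ 2)) 6" using BC by (simp add: coprime_6_iff prime_dvd_power_iff prime_dvd_mult_iff)
    ultimately show "coprime C' 6" using * by metis
  qed
  ultimately have "good_pt (Suc k) A' B' C'" unfolding good_pt_def by blast
  then show ?thesis by blast
qed

lemma good_pt_exists: "\<exists>A B C. good_pt k A B C"
proof (induction k)
  case 0
  then show ?case using good_pt_base by blast
next
  case (Suc k)
  then show ?case using good_pt_double by blast
qed

text \<open>Translating \<open>25 / 16\<close> by a good point gives \<open>X = y / (16 m)\<close>.
  Since \<open>X - 25 / 16 = (y - 25 m) / (16 m)\<close>, the last condition makes the
  \<open>X\<close> for different \<open>k\<close> distinct.\<close>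

lemma param_exists:
  "\<exists>m y W s :: int. W ^ 2 = 625 * (y ^ 2 - 2 * (16 * m) ^ 2) ^ 2 - 49 * (16 * m) ^ 2 * y ^ 2 \<and>
     coprime m 6 \<and> coprime y 6 \<and> odd s \<and> y - 25 * m = 2 ^ Suc k * s"
proof -
  obtain A B C where g: "good_pt (Suc k) A B C" using good_pt_exists by blast
  then have pt: "curve_pt A B C" and k: "2 ^ Suc (Suc k) dvd C - 25 * B ^ 2" and BC: "coprime B 6" "coprime C 6"
    unfolding good_pt_def by auto
  obtain s where s: "odd s" "A = 2 ^ Suc k * s" using g unfolding good_pt_def by blast
  obtain t where t: "C - 25 * B ^ 2 = 2 ^ Suc (Suc k) * t" using k by blast
  define m y where m: "m = B ^ 2 - 5625 * A ^ 2" and y: "y = C + 45 * A * B"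
  have "even A" using s by simp
  have "coprime m 6" using BC \<open>even A\<close>
    unfolding m coprime_6_iff by (auto simp: prime_dvd_power_iff dvd_diff_left_iff)
  moreover have "coprime y 6" using BC \<open>even A\<close>
    unfolding y coprime_6_iff by (auto simp: dvd_add_left_iff)
  \<comment> \<open>The term \<open>45 A B\<close> alone determines the valuation:
    \<open>C - 25 B^2\<close> and \<open>A^2\<close> contribute higher powers of 2.\<close>
  moreover have "y - 25 * m = 2 ^ Suc k * (2 * t + 45 * s * B + 140625 * 2 ^ Suc k * s ^ 2)"
    unfolding m y using t by (simp add: s algebra_simps power2_eq_square)
  moreover have "odd (2 * t + 45 * s * B + 140625 * 2 ^ Suc k * s ^ 2)"
    using s BC by (simp add: coprime_6_iff)
  ultimately show ?thesis
    using curve_pt_translate[OF pt] unfolding m y by blast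
qed

section \<open>From quartic points to infinitely many sextuples\<close>

lemma quartic_dehomogenize:
  fixes w x y :: rat
  assumes "w ^ 2 = 625 * (y ^ 2 - 2 * x ^ 2) ^ 2 - 49 * x ^ 2 * y ^ 2" "x \<noteq> 0"
  shows "(w / x ^ 2) ^ 2 = 625 * ((y / x) ^ 2 - 2) ^ 2 - 49 * (y / x) ^ 2"
proof -
  have "(w / x ^ 2) ^ 2 = w ^ 2 / x ^ 4" by (simp add: power_divide)
  also have "\<dots> = 625 * ((y / x) ^ 2 - 2) ^ 2 - 49 * (y / x) ^ 2"
    unfolding assms(1) using assms(2) by (simp add: power_divide divide_simps) algebra
  finally show ?thesis .
qed

lemma fam_set_sextuple:
  fixes m y W :: int
  assumes W: "W ^ 2 = 625 * (y ^ 2 - 2 * (16 * m) ^ 2) ^ 2 - 49 * (16 * m) ^ 2 * y ^ 2"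
    and my: "coprime m 6" "coprime y 6"
  defines "X \<equiv> of_int y / of_int (16 * m)" and "V \<equiv> of_int W / of_int ((16 * m) ^ 2)"
  shows "rational_diophantine_sextuple (fam_set X V)"
    and "\<forall>q\<in>fam_set X V. is_square (denominator q)"
proof -
  have odd: "odd m" "odd y" and three: "\<not> 3 dvd m" "\<not> 3 dvd y" using my by (auto simp: coprime_6_iff)
  have nz: "m \<noteq> 0" "y \<noteq> 0" using odd by auto
  have "y ^ 2 \<noteq> 512 * m ^ 2" using odd by (metis even_mult_iff even_numeral even_power)
  then have "of_int (y ^ 2) \<noteq> (of_int (512 * m ^ 2) :: rat)" by (metis of_int_eq_iff)
  then have X2: "X ^ 2 \<noteq> 2" using nz by (simp add: X_def power_divide divide_simps power_mult_distrib)
  have "X \<noteq> 0" using nz by (simp add: X_def)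
  have "(of_int W :: rat) ^ 2 = 625 * (of_int y ^ 2 - 2 * (16 * of_int m) ^ 2) ^ 2 - 49 * (16 * of_int m) ^ 2 * of_int y ^ 2"
    using arg_cong[OF W, of "of_int :: int \<Rightarrow> rat"] by simp
  then have V: "V ^ 2 = 625 * (X ^ 2 - 2) ^ 2 - 49 * X ^ 2"
    using quartic_dehomogenize[of "of_int W" "of_int y" "of_int (16 * m)"] nz
    by (simp add: X_def V_def)
  then have V': "(- V) ^ 2 = 625 * (X ^ 2 - 2) ^ 2 - 49 * X ^ 2" by simp
  \<comment> \<open>Valuations cannot separate \<open>e\<close> from \<open>f\<close>; their
    difference is a nonzero multiple of \<open>V\<close>, and \<open>V\<close> is nonzero because
    \<open>W\<close> is odd.\<close>
  have "odd (W ^ 2)" unfolding W using odd by simp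
  then have "V \<noteq> 0" using nz by (auto simp: V_def)
  have "fam_e X V - fam_e X (- V) = 7 * V * X / (150 * (X ^ 2 - 2) ^ 2)"
    using X2 by (simp add: fam_e_def divide_simps)
  then have ef: "fam_e X V \<noteq> fam_e X (- V)"
    using \<open>V \<noteq> 0\<close> \<open>X \<noteq> 0\<close> X2 by auto
  have V_minus: "- V = of_int (- W) / of_int ((16 * m) ^ 2)" by (simp add: V_def)
  note dy = fam_dyadic[OF odd, folded X_def]
  have dyads: "dyadic 6 (fam_a X)" "dyadic 0 (fam_b X)" "dyadic 24 (fam_c X)" "dyadic 10 (fam_d X)"
    "dyadic 8 (fam_e X V)" "dyadic 8 (fam_e X (- V))"
    using dy(1-4) dy(5)[of W] dy(5)[of "- W"] unfolding V_minus V_def by auto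
  have "distinct [fam_a X, fam_b X, fam_c X, fam_d X, fam_e X V, fam_e X (- V)]"
    using dyads ef by (auto dest: dyadic_unique)
  from distinct_card[OF this] have card: "card (fam_set X V) = 6"
    by (simp add: fam_set_def)
  have swap: "is_square (q * p + 1)" if "is_square (p * q + 1)" for p q :: rat
    using that by (simp add: mult.commute)
  note sq = fam_squares_base[OF V \<open>X \<noteq> 0\<close>, THEN is_nth_powerI]
    fam_squares_e[OF V \<open>X \<noteq> 0\<close> X2, THEN is_nth_powerI]
    fam_squares_e[OF V' \<open>X \<noteq> 0\<close> X2, THEN is_nth_powerI]
    fam_squares_ef[OF V \<open>X \<noteq> 0\<close> X2, THEN is_nth_powerI]
  have "\<forall>p\<in>fam_set X V. \<forall>q\<in>fam_set X V. p \<noteq> q \<longrightarrow> is_square (p * q + 1)"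
    unfolding fam_set_def using sq sq[THEN swap] by blast
  moreover have "0 \<notin> fam_set X V"
    using dyads[THEN dyadic_nonzero] by (auto simp: fam_set_def)
  ultimately show "rational_diophantine_sextuple (fam_set X V)"
    using card by (simp add: rational_diophantine_tuple_def fam_set_def)
  \<comment> \<open>\<open>y\<close> and \<open>16 m\<close> may share factors, so \<open>X\<close>
    is reduced first; the conditions at 2 and 3 carry over through
    \<open>y x' = 16 m y'\<close>.\<close>
  obtain y' x' where q: "quotient_of X = (y', x')" by force
  then have X': "X = of_int y' / of_int x'" and "x' > 0" and cop: "coprime y' x'"
    using quotient_of_div quotient_of_denom_pos quotient_of_coprime by blast+
  have "of_int (y * x') = (of_int (16 * m * y') :: rat)"
    using X' \<open>x' > 0\<close> nz unfolding X_def by (simp add: divide_simps mult_ac)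
  then have eq: "y * x' = 16 * m * y'" by (simp only: of_int_eq_iff)
  then have "even (y * x')" by simp
  with odd have "even x'" by simp
  with cop have "odd y'" using coprime_common_divisor[OF cop, of 2] by auto
  have not3: "\<not> (3 dvd x' \<and> 3 dvd y')"
    using coprime_common_divisor[OF cop, of 3] by auto
  have p3: "prime (3 :: int)" by simp
  have "\<not> 3 dvd (16 * m)" using three p3 by (simp add: prime_dvd_mult_iff)
  have "3 dvd y * x' \<longleftrightarrow> 3 dvd x'" using three by (simp add: prime_dvd_mult_iff[OF p3])
  moreover have "3 dvd 16 * m * y' \<longleftrightarrow> 3 dvd y'"
    using \<open>\<not> 3 dvd (16 * m)\<close> by (simp only: prime_dvd_mult_iff[OF p3, of "16 * m"]) simp
  ultimately have "\<not> 3 dvd x'" "\<not> 3 dvd y'" using eq not3 by auto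
  note den = fam_denominators[OF _ X' _ \<open>even x'\<close> \<open>odd y'\<close> this _ X2]
  show "\<forall>q\<in>fam_set X V. is_square (denominator q)"
    using den[OF V] den[OF V'] cop \<open>x' > 0\<close> by (simp add: fam_set_def coprime_commute)
qed

theorem theorem1:
  shows "infinite {S :: rat set. rational_diophantine_sextuple S \<and>
                                 (\<forall>a\<in>S. is_square (denominator a))}"
proof
  let ?F = "{S :: rat set. rational_diophantine_sextuple S \<and> (\<forall>a\<in>S. is_square (denominator a))}"
  assume "finite ?F"
  obtain m y W s :: "nat \<Rightarrow> int" where
    W: "\<And>k. W k ^ 2 = 625 * (y k ^ 2 - 2 * (16 * m k) ^ 2) ^ 2 - 49 * (16 * m k) ^ 2 * y k ^ 2"
    and my: "\<And>k. coprime (m k) 6" "\<And>k. coprime (y k) 6"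
    and s: "\<And>k. odd (s k)" "\<And>k. y k - 25 * m k = 2 ^ Suc k * s k"
    using param_exists by metis
  define X where "X k = (of_int (y k) / of_int (16 * m k) :: rat)" for k
  have odd_m: "odd (m k)" for k using my(1)[of k] by (simp add: coprime_6_iff)
  then have m0: "m k \<noteq> 0" for k by (metis even_zero)
  have "inj X"
  proof (rule injI)
    fix k l assume "X k = X l"
    then have "of_int (y k * m l) = (of_int (y l * m k) :: rat)"
      using m0[of k] m0[of l] by (simp add: X_def divide_simps)
    then have "y k * m l = y l * m k" by (simp only: of_int_eq_iff)
    then have "(y k - 25 * m k) * m l = (y l - 25 * m l) * m k" by (simp add: algebra_simps)
    then have "2 ^ Suc k * (s k * m l) = 2 ^ Suc l * (s l * m k)" by (simp only: s mult.assoc)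
    then have "Suc k = Suc l" using s odd_m by (intro odd_power2_mult_eq[of "s k * m l" "s l * m k"]) auto
    then show "k = l" by simp
  qed
  then have "infinite (range X)" using finite_imageD infinite_UNIV_nat by blast
  \<comment> \<open>Finitely many sextuples would have a finite union, but \<open>fam_a\<close> is
    at most two-to-one on the infinitely many \<open>X k\<close>.\<close>
  have "fam_a (X k) \<in> \<Union> ?F" for k
  proof -
    let ?S = "fam_set (X k) (of_int (W k) / of_int ((16 * m k) ^ 2))"
    have "?S \<in> ?F" using fam_set_sextuple[OF W my] unfolding X_def by blast
    moreover have "fam_a (X k) \<in> ?S" by (simp add: fam_set_def)
    ultimately show ?thesis by blast
  qed
  then have "fam_a ` range X \<subseteq> \<Union> ?F" by blast
  moreover have "finite (\<Union> ?F)"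
    using \<open>finite ?F\<close> by (auto simp: rational_diophantine_tuple_def)
  ultimately have "finite (fam_a ` range X)" by (rule finite_subset)
  then obtain z where "infinite {q \<in> range X. fam_a q = fam_a z}"
    using pigeonhole_infinite[OF \<open>infinite (range X)\<close>] by metis
  moreover have "{q \<in> range X. fam_a q = fam_a z} \<subseteq> {z, - z}"
    by (auto simp: fam_a_def power2_eq_iff)
  ultimately show False by (meson finite.simps finite_subset)
qed

end
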